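(* Let $(X,d)$ be a metric space, $Y$ a topological space, $\pi:X\to Y$ a quotient map, $L\ge1$ and $M\ge0$. Assume that every point $x\in X$ is contained in the image of an intrinsically $(L,M)$-quasi-isometric section $\psi_x$ of $\pi$ (fix one such $\psi_x$ for each $x$). Then for every section $\phi:Y\to X$ of $\pi$ the following are equivalent: (1) there exist $L_1\ge1$ and $M_1\ge0$ such that for all $x\in\phi(Y)$ the section $\phi$ is intrinsically $(L_1,M_1)$-quasi-isometric with respect to $\psi_x$ at $x$; (2) there exist $L_2\ge1$ and $M_2\ge0$ such that $\phi$ is intrinsically $(L_2,M_2)$-quasi-isometric. Moreover, if the sections $\psi_x$ are intrinsically Lipschitz (i.e. $M=0$), then $M_1=M_2$, that is, the equivalence holds with the same additive constant in (1) and (2).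
   Context: A quotient map is a continuous, open and surjective map. For $A\subset X$ and $x\in X$, $d(x,A):=\inf\{d(x,a):a\in A\}$. A section of $\pi$ is a map $\phi:Y\to X$ with $\pi\circ\phi=\mathrm{id}_Y$ (no continuity required). A section $\phi$ is intrinsically $(L,M)$-quasi-isometric ($L\ge1$, $M\ge0$) if $d(\phi(y_1),\phi(y_2))\le L\,d(\phi(y_1),\pi^{-1}(y_2))+M$ for all $y_1,y_2\in Y$. Given sections $\phi,\psi$ of $\pi$ and $\hat x\in X$, $\phi$ is intrinsically $(L,M)$-quasi-isometric with respect to $\psi$ at the point $\hat x$ if $\hat x\in\psi(Y)\cap\phi(Y)$ and $\phi(Y)\cap C^{\psi}_{\hat x,L}=\emptyset$, where $$C^{\psi}_{\hat x,L}:=\{x\in X: d(x,\psi(\pi(x)))>L\,d(\hat x,\psi(\pi(x)))+M\}.$$ Equivalently, there is $\hat y\in Y$ with $\hat x=\phi(\hat y)=\psi(\hat y)$ and $d(\phi(y),\psi(y))\le L\,d(\psi(\hat y),\psi(y))+M$ for all $y\in Y$. *)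

theory Defs
  imports "HOL-Analysis.Analysis"
begin

text \<open>Here a quotient map is required to be open, which is stronger than the library's
  \<^const>\<open>quotient_map\<close>.\<close>

definition open_quotient_map :: "('a::topological_space \<Rightarrow> 'b::topological_space) \<Rightarrow> bool" where
  "open_quotient_map \<pi> \<longleftrightarrow>
     continuous_on UNIV \<pi> \<and> open_map euclidean euclidean \<pi> \<and> surj \<pi>"

definition is_section :: "('a \<Rightarrow> 'b) \<Rightarrow> ('b \<Rightarrow> 'a) \<Rightarrow> bool" where
  "is_section \<pi> \<phi> \<longleftrightarrow> \<pi> \<circ> \<phi> = id"

text \<open>\<^const>\<open>infdist\<close> returns \<open>0\<close> on the empty set; the fibres are nonempty whenever \<open>\<pi>\<close>
  has a section.\<close>

definition intrinsically_qi ::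
    "('a::metric_space \<Rightarrow> 'b) \<Rightarrow> real \<Rightarrow> real \<Rightarrow> ('b \<Rightarrow> 'a) \<Rightarrow> bool" where
  "intrinsically_qi \<pi> L M \<phi> \<longleftrightarrow>
     (\<forall>y1 y2. dist (\<phi> y1) (\<phi> y2) \<le> L * infdist (\<phi> y1) (\<pi> -` {y2}) + M)"

definition intrinsic_cone ::
    "('a::metric_space \<Rightarrow> 'b) \<Rightarrow> real \<Rightarrow> real \<Rightarrow> ('b \<Rightarrow> 'a) \<Rightarrow> 'a \<Rightarrow> 'a set" where
  "intrinsic_cone \<pi> L M \<psi> p = {x. dist x (\<psi> (\<pi> x)) > L * dist p (\<psi> (\<pi> x)) + M}"

definition intrinsically_qi_wrt_at ::
    "('a::metric_space \<Rightarrow> 'b) \<Rightarrow> real \<Rightarrow> real \<Rightarrow> ('b \<Rightarrow> 'a) \<Rightarrow> ('b \<Rightarrow> 'a) \<Rightarrow> 'a \<Rightarrow> bool" where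
  "intrinsically_qi_wrt_at \<pi> L M \<phi> \<psi> p \<longleftrightarrow>
     p \<in> range \<psi> \<inter> range \<phi> \<and> range \<phi> \<inter> intrinsic_cone \<pi> L M \<psi> p = {}"

end

theory Submission
  imports Defs
begin

text \<open>Let \<open>x = \<phi> y\<^sub>1\<close>, and let \<open>z = \<psi>\<^sub>x y\<^sub>2\<close> be the point of the reference section through \<open>x\<close>
  over \<open>y\<^sub>2\<close>. The triangle inequality in \<open>x\<close>, \<open>z\<close>, \<open>\<phi> y\<^sub>2\<close> says that \<open>dist x (\<phi> y\<^sub>2)\<close> and
  \<open>dist (\<phi> y\<^sub>2) z\<close> differ by at most \<open>dist x z\<close>, and \<open>dist x z\<close> is comparable to the
  distance \<open>\<delta>\<close> of \<open>x\<close> from the fibre over \<open>y\<^sub>2\<close>: we have \<open>\<delta> \<le> dist x z\<close> because \<open>z\<close> lies in that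
  fibre, and \<open>dist x z \<le> L * \<delta> + M\<close> because \<open>\<psi>\<^sub>x\<close> is quasi-isometric.

  If \<open>\<phi>\<close> is \<open>(L\<^sub>2, M\<^sub>2)\<close>-quasi-isometric, the first estimate for \<open>\<delta>\<close> gives the pointwise
  condition with constants \<open>(1 + L\<^sub>2, M\<^sub>2)\<close>. If the pointwise condition holds with constants
  \<open>(L\<^sub>1, M\<^sub>1)\<close>, the second one shows that \<open>\<phi>\<close> is quasi-isometric with constants
  \<open>((1 + L\<^sub>1) * L, (1 + L\<^sub>1) * M + M\<^sub>1)\<close>. For \<open>M = 0\<close> both steps keep the additive constant.\<close>

lemma is_sectionD: "is_section \<pi> \<phi> \<Longrightarrow> \<pi> (\<phi> y) = y"
  by (metis comp_apply id_apply is_section_def)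

lemma section_value_at_image:
  assumes "is_section \<pi> \<psi>" and "x \<in> range \<psi>"
  shows "\<psi> (\<pi> x) = x"
  using assms by (auto simp: is_sectionD)

lemma intrinsically_qi_wrt_at_iff:
  assumes "is_section \<pi> \<phi>"
  shows "intrinsically_qi_wrt_at \<pi> L M \<phi> \<psi> p \<longleftrightarrow>
    p \<in> range \<psi> \<inter> range \<phi> \<and> (\<forall>y. dist (\<phi> y) (\<psi> y) \<le> L * dist p (\<psi> y) + M)"
proof -
  have "range \<phi> \<inter> intrinsic_cone \<pi> L M \<psi> p = {} \<longleftrightarrow> (\<forall>y. \<phi> y \<notin> intrinsic_cone \<pi> L M \<psi> p)"
    by blast
  then show ?thesis
    by (simp add: intrinsically_qi_wrt_at_def intrinsic_cone_def is_sectionD[OF assms] not_less)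
qed

lemma intrinsically_qi_if_wrt_at:
  fixes \<pi> :: "'a::metric_space \<Rightarrow> 'b" and \<psi> :: "'a \<Rightarrow> 'b \<Rightarrow> 'a"
  assumes \<phi>: "is_section \<pi> \<phi>"
    and \<psi>: "\<And>x. x \<in> range \<phi> \<Longrightarrow> is_section \<pi> (\<psi> x)"
    and qi: "\<And>x. x \<in> range \<phi> \<Longrightarrow> intrinsically_qi \<pi> L M (\<psi> x)"
    and wrt: "\<And>x. x \<in> range \<phi> \<Longrightarrow> intrinsically_qi_wrt_at \<pi> L1 M1 \<phi> (\<psi> x) x"
    and L1: "L1 \<ge> 0"
  shows "intrinsically_qi \<pi> ((1 + L1) * L) ((1 + L1) * M + M1) \<phi>"
  unfolding intrinsically_qi_def
proof (intro allI)
  fix y1 y2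
  define x where "x = \<phi> y1"
  have x: "x \<in> range \<phi>" and "\<pi> x = y1"
    using is_sectionD[OF \<phi>] by (auto simp: x_def)
  have near: "dist (\<phi> y2) (\<psi> x y2) \<le> L1 * dist x (\<psi> x y2) + M1"
    and "x \<in> range (\<psi> x)"
    using wrt[OF x] by (auto simp: intrinsically_qi_wrt_at_iff[OF \<phi>])
  then have "\<psi> x y1 = x"
    using section_value_at_image[OF \<psi>[OF x]] \<open>\<pi> x = y1\<close> by auto
  then have far: "dist x (\<psi> x y2) \<le> L * infdist x (\<pi> -` {y2}) + M"
    using qi[OF x] unfolding intrinsically_qi_def by metis
  have "dist x (\<phi> y2) \<le> dist x (\<psi> x y2) + dist (\<phi> y2) (\<psi> x y2)"
    by (rule dist_triangle2)
  also have "\<dots> \<le> (1 + L1) * dist x (\<psi> x y2) + M1"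
    using near by (simp add: algebra_simps)
  also have "\<dots> \<le> (1 + L1) * (L * infdist x (\<pi> -` {y2}) + M) + M1"
    using far L1 by (intro add_right_mono mult_left_mono) auto
  finally show "dist (\<phi> y1) (\<phi> y2)
      \<le> (1 + L1) * L * infdist (\<phi> y1) (\<pi> -` {y2}) + ((1 + L1) * M + M1)"
    by (simp add: x_def algebra_simps)
qed

text \<open>Here the reference section \<open>\<psi>\<close> need not be quasi-isometric.\<close>

lemma intrinsically_qi_imp_wrt_at:
  fixes \<pi> :: "'a::metric_space \<Rightarrow> 'b"
  assumes \<phi>: "is_section \<pi> \<phi>" and \<psi>: "is_section \<pi> \<psi>"
    and qi: "intrinsically_qi \<pi> L2 M2 \<phi>"
    and L2: "L2 \<ge> 0"
    and x: "x \<in> range \<psi> \<inter> range \<phi>"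
  shows "intrinsically_qi_wrt_at \<pi> (1 + L2) M2 \<phi> \<psi> x"
  unfolding intrinsically_qi_wrt_at_iff[OF \<phi>]
proof (intro conjI allI x)
  fix y
  have "\<phi> (\<pi> x) = x"
    using section_value_at_image[OF \<phi>] x by simp
  then have "dist x (\<phi> y) \<le> L2 * infdist x (\<pi> -` {y}) + M2"
    using qi unfolding intrinsically_qi_def by metis
  also have "\<dots> \<le> L2 * dist x (\<psi> y) + M2"
    using L2 is_sectionD[OF \<psi>]
    by (intro add_right_mono mult_left_mono infdist_le) auto
  finally have "dist x (\<phi> y) \<le> L2 * dist x (\<psi> y) + M2" .
  with dist_triangle3[of "\<phi> y" "\<psi> y" x]
  show "dist (\<phi> y) (\<psi> y) \<le> (1 + L2) * dist x (\<psi> y) + M2"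
    by (simp add: algebra_simps)
qed

theorem proposition1p3:
  fixes \<pi> :: "'a::metric_space \<Rightarrow> 'b::topological_space"
    and L M :: real
    and \<psi> :: "'a \<Rightarrow> 'b \<Rightarrow> 'a"
    and \<phi> :: "'b \<Rightarrow> 'a"
  assumes "open_quotient_map \<pi>"
    and "L \<ge> 1" and "M \<ge> 0"
    and "\<And>x. is_section \<pi> (\<psi> x)"
    and "\<And>x. intrinsically_qi \<pi> L M (\<psi> x)"
    and "\<And>x. x \<in> range (\<psi> x)"
    and "is_section \<pi> \<phi>"
  shows "((\<exists>L1\<ge>1. \<exists>M1\<ge>0. \<forall>x\<in>range \<phi>. intrinsically_qi_wrt_at \<pi> L1 M1 \<phi> (\<psi> x) x) \<longleftrightarrow>
          (\<exists>L2\<ge>1. \<exists>M2\<ge>0. intrinsically_qi \<pi> L2 M2 \<phi>)) \<and>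
         (M = 0 \<longrightarrow>
          (\<forall>N\<ge>0. (\<exists>L1\<ge>1. \<forall>x\<in>range \<phi>. intrinsically_qi_wrt_at \<pi> L1 N \<phi> (\<psi> x) x) \<longleftrightarrow>
                 (\<exists>L2\<ge>1. intrinsically_qi \<pi> L2 N \<phi>)))"
proof -
  have L_ge: "(1 + L1) * L \<ge> 1" if "L1 \<ge> 1" for L1
    using mult_mono[of 1 "1 + L1" 1 L] that \<open>L \<ge> 1\<close> by simp
  have to_qi: "intrinsically_qi \<pi> ((1 + L1) * L) ((1 + L1) * M + M1) \<phi>"
    if "L1 \<ge> 1" "\<forall>x\<in>range \<phi>. intrinsically_qi_wrt_at \<pi> L1 M1 \<phi> (\<psi> x) x" for L1 M1
    using that assms(4,5,7) by (intro intrinsically_qi_if_wrt_at[of \<pi> \<phi> \<psi>]) auto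
  have to_wrt: "\<forall>x\<in>range \<phi>. intrinsically_qi_wrt_at \<pi> (1 + L2) M2 \<phi> (\<psi> x) x"
    if "L2 \<ge> 1" "intrinsically_qi \<pi> L2 M2 \<phi>" for L2 M2
    using that assms(4,6,7) by (intro ballI intrinsically_qi_imp_wrt_at) auto
  show ?thesis
  proof (intro conjI impI allI iffI)
    assume "\<exists>L1\<ge>1. \<exists>M1\<ge>0. \<forall>x\<in>range \<phi>. intrinsically_qi_wrt_at \<pi> L1 M1 \<phi> (\<psi> x) x"
    then obtain L1 M1 where "L1 \<ge> 1" "M1 \<ge> 0"
      and "\<forall>x\<in>range \<phi>. intrinsically_qi_wrt_at \<pi> L1 M1 \<phi> (\<psi> x) x" by blast
    moreover have "(1 + L1) * M + M1 \<ge> 0"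
      using \<open>L1 \<ge> 1\<close> \<open>M1 \<ge> 0\<close> \<open>M \<ge> 0\<close> by simp
    ultimately show "\<exists>L2\<ge>1. \<exists>M2\<ge>0. intrinsically_qi \<pi> L2 M2 \<phi>"
      using to_qi L_ge by blast
  next
    assume "\<exists>L2\<ge>1. \<exists>M2\<ge>0. intrinsically_qi \<pi> L2 M2 \<phi>"
    then obtain L2 M2 where "L2 \<ge> 1" "M2 \<ge> 0" "intrinsically_qi \<pi> L2 M2 \<phi>" by blast
    moreover from \<open>L2 \<ge> 1\<close> have "1 + L2 \<ge> 1" by simp
    ultimately show "\<exists>L1\<ge>1. \<exists>M1\<ge>0. \<forall>x\<in>range \<phi>. intrinsically_qi_wrt_at \<pi> L1 M1 \<phi> (\<psi> x) x"
      using to_wrt by blast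
  next
    fix N :: real
    assume "M = 0" and "\<exists>L1\<ge>1. \<forall>x\<in>range \<phi>. intrinsically_qi_wrt_at \<pi> L1 N \<phi> (\<psi> x) x"
    then obtain L1 where "L1 \<ge> 1" "intrinsically_qi \<pi> ((1 + L1) * L) N \<phi>"
      using to_qi by fastforce
    then show "\<exists>L2\<ge>1. intrinsically_qi \<pi> L2 N \<phi>"
      using L_ge by blast
  next
    fix N :: real
    assume "\<exists>L2\<ge>1. intrinsically_qi \<pi> L2 N \<phi>"
    then obtain L2 where "L2 \<ge> 1" "intrinsically_qi \<pi> L2 N \<phi>" by blast
    moreover from \<open>L2 \<ge> 1\<close> have "1 + L2 \<ge> 1" by simp
    ultimately show "\<exists>L1\<ge>1. \<forall>x\<in>range \<phi>. intrinsically_qi_wrt_at \<pi> L1 N \<phi> (\<psi> x) x"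
      using to_wrt by blast
  qed
qed

end
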